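(* Let $D$ be an infinite unique factorization domain with a finite number of units. Then $D$ has an infinite number of prime elements. *)

theory Defs
  imports "HOL-Algebra.Ring_Divisibility"
begin

end

theory Submission
  imports Defs
begin

text \<open>
  Euclid's argument, applied to a common multiple \<open>q\<close> of all primes, stalls in a general ring
  because \<open>1 + q\<close> may be a unit or zero and then contradicts nothing.  The remedy is to replace this
  single element by the whole family \<open>1 + q \<cdot> a\<close>, with \<open>a\<close> ranging over the ring.

  If there were only finitely many primes, they would have a nonzero common multiple \<open>q\<close>
  (\<open>exists_nonzero_common_multiple\<close>).  A prime dividing \<open>1 + q \<cdot> a\<close> also divides \<open>q\<close>, hence is a
  unit (\<open>common_divisor_one_plus_multiple_is_unit\<close>), which is absurd; so by
  \<open>exists_prime_divisor\<close> every member of the family is a unit or zero.  As \<open>q\<close> is cancellable,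
  \<open>a \<mapsto> 1 + q \<cdot> a\<close> is injective (\<open>inj_on_one_plus_multiple\<close>), and it embeds the infinite ring into
  the finite set of units together with zero.  The case of no primes at all (a field) is
  covered by the same argument, since any nonzero \<open>q\<close> is then a common multiple.
\<close>

text \<open>Unique factorization enters only here: it provides an irreducible factor and makes this factor
  prime.  Factorizations live in the multiplicative monoid of nonzero elements, so divisibility and
  primality have to be carried back to the ring.\<close>

lemma (in factorial_domain) exists_prime_divisor:
  assumes "a \<in> carrier R" "a \<noteq> \<zero>" "a \<notin> Units R"
  shows "\<exists>p \<in> carrier R. ring_prime p \<and> p divides a"
proof -
  have a: "a \<in> carrier (mult_of R)" "a \<notin> Units (mult_of R)"
    using assms by auto
  then obtain fs where fs: "set fs \<subseteq> carrier (mult_of R)" "factors (mult_of R) fs a"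
    using factors_exist by blast
  \<comment> \<open>The empty product is a unit, so at least one irreducible factor occurs.\<close>
  with a have "fs \<noteq> []"
    by (auto simp: factors_def)
  then have hd_fs: "hd fs \<in> set fs"
    by simp
  obtain p where p: "p \<in> carrier (mult_of R)" "irreducible (mult_of R) p" "p divides\<^bsub>mult_of R\<^esub> a"
  proof (rule that)
    show "hd fs \<in> carrier (mult_of R)" "irreducible (mult_of R) (hd fs)"
      using fs hd_fs by (auto simp: factors_def)
    show "hd fs divides\<^bsub>mult_of R\<^esub> a"
      using mult_of.factors_dividesI[OF fs(2) hd_fs fs(1)] .
  qed
  have "prime (mult_of R) p"
    using p by (intro irreducible_prime) auto
  then have "ring_prime p"
    using p prime_eq_prime_mult unfolding ring_prime_def by auto
  with p show ?thesis
    by auto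
qed

text \<open>The product of the set serves as the common multiple; it is nonzero because the ring has no
  zero divisors.\<close>

lemma (in domain) exists_nonzero_common_multiple:
  assumes "finite A" "A \<subseteq> carrier R - {\<zero>}"
  shows "\<exists>q \<in> carrier R - {\<zero>}. \<forall>p \<in> A. p divides q"
  using assms
proof (induction A)
  case empty
  show ?case
    using one_closed one_not_zero by blast
next
  case (insert p A)
  then obtain q where q: "q \<in> carrier R - {\<zero>}" "\<forall>p \<in> A. p divides q"
    by auto
  have p: "p \<in> carrier R - {\<zero>}" "A \<subseteq> carrier R"
    using insert.prems by auto
  have "p \<otimes> q \<in> carrier R - {\<zero>}"
    using p q integral_iff by auto
  moreover have "p divides (p \<otimes> q)"
    using q by (intro dividesI[of q]) auto
  moreover have "r divides (p \<otimes> q)" if "r \<in> A" for r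
    using that p q by (intro divides_prod_l) auto
  ultimately show ?case
    by blast
qed

text \<open>The Euclid step: modulo any divisor \<open>p\<close> of \<open>q\<close> the element \<open>1 + q \<cdot> a\<close> is \<open>1\<close>.\<close>

lemma (in cring) common_divisor_one_plus_multiple_is_unit:
  assumes "p \<in> carrier R" "q \<in> carrier R" "a \<in> carrier R"
    and "p divides q" "p divides (\<one> \<oplus> q \<otimes> a)"
  shows "p \<in> Units R"
proof -
  obtain c where c: "c \<in> carrier R" "q = p \<otimes> c"
    using assms(4) by (rule dividesE)
  obtain d where d: "d \<in> carrier R" "\<one> \<oplus> q \<otimes> a = p \<otimes> d"
    using assms(5) by (rule dividesE)
  have "\<one> = (\<one> \<oplus> q \<otimes> a) \<ominus> q \<otimes> a"
    using assms by algebra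
  also have "\<dots> = p \<otimes> (d \<ominus> c \<otimes> a)"
    unfolding d(2) using c d(1) assms(1,3) by algebra
  finally have "p divides \<one>"
    using assms c d by (intro dividesI[of "d \<ominus> c \<otimes> a"]) auto
  then show ?thesis
    using divides_one assms by simp
qed

lemma (in domain) inj_on_one_plus_multiple:
  assumes "q \<in> carrier R - {\<zero>}"
  shows "inj_on (\<lambda>a. \<one> \<oplus> q \<otimes> a) (carrier R)"
proof (rule inj_onI)
  fix a b assume ab: "a \<in> carrier R" "b \<in> carrier R" and eq: "\<one> \<oplus> q \<otimes> a = \<one> \<oplus> q \<otimes> b"
  have "q \<in> carrier R" "q \<noteq> \<zero>"
    using assms by blast+
  moreover have "q \<otimes> a = q \<otimes> b"
    using eq add.l_cancel[of \<one> "q \<otimes> a" "q \<otimes> b"] \<open>q \<in> carrier R\<close> ab one_closed m_closed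
    by metis
  ultimately show "a = b"
    using m_lcancel ab by metis
qed

theorem proposition4p2:
  fixes D :: "('a, 'b) ring_scheme"
  assumes "factorial_domain D"
    and "infinite (carrier D)"
    and "finite (Units D)"
  shows "infinite {p \<in> carrier D. ring_prime\<^bsub>D\<^esub> p}"
proof
  interpret factorial_domain D
    by fact
  let ?P = "{p \<in> carrier D. ring_prime\<^bsub>D\<^esub> p}"
  let ?f = "\<lambda>q a. \<one>\<^bsub>D\<^esub> \<oplus>\<^bsub>D\<^esub> q \<otimes>\<^bsub>D\<^esub> a"
  assume "finite ?P"
  moreover have "?P \<subseteq> carrier D - {\<zero>\<^bsub>D\<^esub>}"
    by (auto simp: ring_prime_def)
  ultimately obtain q where q: "q \<in> carrier D - {\<zero>\<^bsub>D\<^esub>}" "\<forall>p \<in> ?P. p divides\<^bsub>D\<^esub> q"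
    using exists_nonzero_common_multiple by blast
  have "?f q ` carrier D \<subseteq> insert \<zero>\<^bsub>D\<^esub> (Units D)"
  proof (rule image_subsetI, rule ccontr)
    fix a assume a: "a \<in> carrier D" and not_unit: "?f q a \<notin> insert \<zero>\<^bsub>D\<^esub> (Units D)"
    have "q \<in> carrier D"
      using q(1) by blast
    then have "?f q a \<in> carrier D"
      using a by (intro add.m_closed m_closed one_closed)
    then obtain p where p: "p \<in> carrier D" "ring_prime\<^bsub>D\<^esub> p" "p divides\<^bsub>D\<^esub> (?f q a)"
      using exists_prime_divisor not_unit by blast
    moreover have "p divides\<^bsub>D\<^esub> q"
      using q(2) p by blast
    ultimately have "p \<in> Units D"
      using common_divisor_one_plus_multiple_is_unit \<open>q \<in> carrier D\<close> a by blast
    with p(2) show False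
      unfolding ring_prime_def prime_def by blast
  qed
  then have "finite (?f q ` carrier D)"
    using assms(3) finite_subset by blast
  then have "finite (carrier D)"
    using inj_on_one_plus_multiple[OF q(1)] by (rule finite_imageD)
  with assms(2) show False
    by contradiction
qed

end
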